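(* Let the system, sampled-state sets $\mathcal{X}_s,\mathcal{X}_u$, parameterized functions $h(\cdot;\vartheta)$, $\gamma(r)=\gamma_0 r$, $\pi(\cdot;\kappa)$, constants, and loss function $\mathcal{L}$ be as defined in the context. If the parameters $(\vartheta,\gamma_0,\kappa)$ satisfy $\mathcal{L}(\mathcal{X}_s,\mathcal{X}_u;\vartheta,\gamma_0,\kappa)=0$, then: (1) $\gamma\in\mathcal{K}_\infty^{\leqslant\mathrm{id}}$, and for every $x\in\mathcal{X}_s$ with $h(x;\vartheta)\geqslant 0$ there exists $u\in\mathbb{U}$ such that $$h(f(x,u);\vartheta)-h(x;\vartheta)+\gamma(h(x;\vartheta))\geqslant \widetilde{L}_h w_{\max};$$ (2) $\lVert\nabla_x h(x;\vartheta)\rVert\leqslant\widetilde{L}_h$ for every $x\in\mathcal{X}_s$ with $h(x;\vartheta)\geqslant 0$; (3) $h(x;\vartheta)<0$ for every $x\in\mathcal{X}_u$.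
   Context: System: $x_{t+1}=f(x_t,u_t)+w_t$ with $f:\mathbb{R}^n\times\mathbb{R}^m\to\mathbb{R}^n$, inputs $u_t\in\mathbb{U}:=\{u\in\mathbb{R}^m\mid u_{i,\min}\leqslant u_i\leqslant u_{i,\max},\ i=1,\dots,m\}$ with real $u_{i,\min}\leqslant u_{i,\max}$, and disturbances $w_t\in\mathbb{W}\subset\mathbb{R}^n$, where $\lVert w\rVert\leqslant w_{\max}$ for all $w\in\mathbb{W}$, $w_{\max}\in\mathbb{R}_{\geqslant 0}$. $\lVert\cdot\rVert$ is the Euclidean norm. The safe set is $\mathcal{S}:=\{x\in\mathbb{R}^n\mid s_i(x)\geqslant 0,\ i=1,\dots,n_s\}$ for given $s_i:\mathbb{R}^n\to\mathbb{R}$. $\mathcal{K}_\infty^{\leqslant\mathrm{id}}$: the set of continuous strictly increasing functions $\gamma:\mathbb{R}_{\geqslant 0}\to\mathbb{R}_{\geqslant 0}$ with $\gamma(0)=0$, $\lim_{r\to\infty}\gamma(r)=\infty$ and $\gamma(r)\leqslant r$ for all $r\geqslant 0$. Sampled states: $\mathcal{X}_s\subset\mathcal{S}$ and $\mathcal{X}_u\subset\mathbb{R}^n\setminus\mathcal{S}$ are finite sets. Parameterization of $h$: $h(\cdot;\vartheta):\mathbb{R}^n\to\mathbb{R}$ is a combination of continuously differentiable basis functions with coefficient vector $\vartheta\in\mathbb{R}^{n_\vartheta}$. Parameterization of $\gamma$: $\gamma(r):=\gamma_0 r$, where $\gamma_0$ is a trainable real parameter; $0<\gamma_{0,\min}\leqslant\gamma_{0,\max}\leqslant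 1$ are user-specified constants. In the loss, $\gamma(h(x))$ means $\gamma_0 h(x)$, also when $h(x)<0$. Parameterization of the policy: $\pi=[\pi_1\ \cdots\ \pi_m]^\top:\mathbb{R}^n\to\mathbb{R}^m$, where each $\pi_i(x;\kappa)$ is a neural network $y^{(0)}:=x$, $y^{(j)}:=\mathrm{ReLU}(W^{(j)}y^{(j-1)}+b^{(j)})$ for $j\in\{1,\dots,l-1\}$, $\pi_i(x;\kappa):=\mathrm{Hardtanh}(W^{(l)}y^{(l-1)}+b^{(l)},u_{i,\min},u_{i,\max})$, with weights and biases $\kappa=\{W^{(j)},b^{(j)}\}_{j=1}^l$ of compatible dimensions (input dimension $n$, output dimension $1$). Here $\mathrm{ReLU}(y):=\max(0,y)$ (element-wise), and $\mathrm{Hardtanh}(v,a,b)$ equals $b$ if $v\geqslant b$, $v$ if $a\leqslant v\leqslant b$, and $a$ if $v\leqslant a$. Notation: $\mathcal{H}(x,u;\vartheta,\gamma_0):=h(f(x,u);\vartheta)-h(x;\vartheta)+\gamma_0 h(x;\vartheta)$. Constants: $\widetilde{L}_h\in\mathbb{R}_{\geqslant 0}$; $\eta,\delta,\zeta,\phi_0\in\mathbb{R}_{>0}$; $\alpha_1,\dots,\alpha_5\in\mathbb{R}_{>0}$; and $c_1,c_2\in\mathbb{R}_{>0}$ such that the function $\Gamma(z):=\frac{-1}{1+e^{-c_1 z}}+c_2$ satisfies $\Gamma(z)<0$ for $z>-\zeta$ and $\Gamma(z)\geqslant 0$ for $z\leqslant-\zeta$. Loss terms: $$\mathcal{L}_1(\mathcal{X}_s;\vartheta):=\sum_{x\in\mathcal{X}_s}\mathrm{ReLU}\Bigl(\mathrm{ReLU}\bigl(h(x;\vartheta)+\eta\bigr)\bigl(\lVert\nabla_x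 h(x;\vartheta)\rVert-\widetilde{L}_h\bigr)\Bigr),$$ $$\mathcal{L}_2(\mathcal{X}_s;\vartheta,\gamma_0,\kappa):=\sum_{x\in\mathcal{X}_s}\mathrm{ReLU}\Bigl(\Gamma\bigl(h(x;\vartheta)\bigr)\bigl(\mathcal{H}(x,\pi(x;\kappa);\vartheta,\gamma_0)-\widetilde{L}_h w_{\max}\bigr)\Bigr),$$ $\mathcal{L}_3$ is either $\mathcal{L}_3(\vartheta):=\mathrm{ReLU}(-\phi(\vartheta)+\phi_0)$, where $\phi(\vartheta)$ is the area of the zero-superlevel set $\{x\mid h(x;\vartheta)\geqslant 0\}$, or alternatively $\mathcal{L}_3:=\sum_{x\in\mathcal{X}_I}\mathrm{ReLU}(-h(x;\vartheta))$ for a finite set $\mathcal{X}_I$ of initial states, $$\mathcal{L}_4(\mathcal{X}_u;\vartheta):=\sum_{x\in\mathcal{X}_u}\mathrm{ReLU}\bigl(h(x;\vartheta)+\delta\bigr),$$ $$\mathcal{L}_5(\gamma_0):=\mathrm{ReLU}(-\gamma_0+\gamma_{0,\min})+\mathrm{ReLU}(\gamma_0-\gamma_{0,\max}).$$ The loss function is $$\mathcal{L}(\mathcal{X}_s,\mathcal{X}_u;\vartheta,\gamma_0,\kappa):=\alpha_1\mathcal{L}_1+\alpha_2\mathcal{L}_2+\alpha_3\mathcal{L}_3+\alpha_4\mathcal{L}_4+\alpha_5\mathcal{L}_5.$$ *)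

theory Defs
  imports "HOL-Analysis.Analysis" "Jordan_Normal_Form.Matrix"
begin

(* Both libraries use $ for vector components; here $ is reserved for real^'n. *)
no_notation vec_index (infixl "$" 100)

definition input_set :: "real^'m \<Rightarrow> real^'m \<Rightarrow> (real^'m) set" where
  "input_set umin umax = {u. \<forall>i. umin $ i \<le> u $ i \<and> u $ i \<le> umax $ i}"

definition safe_set :: "nat \<Rightarrow> (nat \<Rightarrow> real^'n \<Rightarrow> real) \<Rightarrow> (real^'n) set" where
  "safe_set ns s = {x. \<forall>i\<in>{1..ns}. s i x \<ge> 0}"

(* Functions on the nonnegative reals are represented by functions on all reals that
   are constrained only on {0..}. *)
definition K_inf_le_id :: "(real \<Rightarrow> real) set" where
  "K_inf_le_id = {g. continuous_on {0..} g \<and> strict_mono_on {0..} g \<and> g ` {0..} \<subseteq> {0..} \<and>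
     g 0 = 0 \<and> filterlim g at_top at_top \<and> (\<forall>r\<ge>0. g r \<le> r)}"

definition gamma_fun :: "real \<Rightarrow> real \<Rightarrow> real" where
  "gamma_fun \<gamma>0 r = \<gamma>0 * r"

definition grad :: "('a::real_inner \<Rightarrow> real) \<Rightarrow> 'a \<Rightarrow> 'a" where
  "grad h x = (THE D. GDERIV h x :> D)"

definition continuously_differentiable :: "('a::real_inner \<Rightarrow> real) \<Rightarrow> bool" where
  "continuously_differentiable h \<longleftrightarrow>
     (\<exists>D. (\<forall>x. GDERIV h x :> D x) \<and> continuous_on UNIV D)"

definition relu :: "'a::{zero,linorder} \<Rightarrow> 'a" where
  "relu y = max 0 y"

definition hardtanh :: "real \<Rightarrow> real \<Rightarrow> real \<Rightarrow> real" where
  "hardtanh v a b = (if v \<ge> b then b else if v \<ge> a then v else a)"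

(* Layer widths vary within one network, so weights and biases are matrices and vectors with
   explicit dimensions. weight and bias are used at the layers 1..depth, width at 0..depth. *)
record network =
  depth :: nat
  width :: "nat \<Rightarrow> nat"
  weight :: "nat \<Rightarrow> real mat"
  bias :: "nat \<Rightarrow> real Matrix.vec"

definition compatible_dims :: "nat \<Rightarrow> network \<Rightarrow> bool" where
  "compatible_dims n N \<longleftrightarrow>
     depth N \<ge> 1 \<and> width N 0 = n \<and> width N (depth N) = 1 \<and>
     (\<forall>j\<in>{1..depth N}. weight N j \<in> carrier_mat (width N j) (width N (j - 1)) \<and>
                       bias N j \<in> carrier_vec (width N j))"

(* from_nat_into UNIV enumerates the finite index type 'n by 0..<CARD('n). *)
definition to_dim_vec :: "real^'n \<Rightarrow> real Matrix.vec" where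
  "to_dim_vec x = Matrix.vec CARD('n) (\<lambda>i. x $ from_nat_into (UNIV :: 'n set) i)"

definition pre_activation :: "network \<Rightarrow> nat \<Rightarrow> real Matrix.vec \<Rightarrow> real Matrix.vec" where
  "pre_activation N j y = weight N j *\<^sub>v y + bias N j"

primrec layer_output :: "network \<Rightarrow> real Matrix.vec \<Rightarrow> nat \<Rightarrow> real Matrix.vec" where
  "layer_output N y 0 = y"
| "layer_output N y (Suc j) = map_vec relu (pre_activation N (Suc j) (layer_output N y j))"

definition network_output :: "network \<Rightarrow> real \<Rightarrow> real \<Rightarrow> real Matrix.vec \<Rightarrow> real" where
  "network_output N a b y =
     hardtanh (vec_index (pre_activation N (depth N) (layer_output N y (depth N - 1))) 0) a b"

(* Each component has its own network; equal \<kappa> i for all i is the case of shared parameters. *)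
definition policy ::
  "real^'m \<Rightarrow> real^'m \<Rightarrow> ('m \<Rightarrow> network) \<Rightarrow> real^'n \<Rightarrow> real^'m" where
  "policy umin umax \<kappa> x =
     (\<chi> i. network_output (\<kappa> i) (umin $ i) (umax $ i) (to_dim_vec x))"

definition H_fun ::
  "(real^'n \<Rightarrow> real^'m \<Rightarrow> real^'n) \<Rightarrow> (real^'n \<Rightarrow> real) \<Rightarrow> real \<Rightarrow> real^'n \<Rightarrow> real^'m \<Rightarrow> real" where
  "H_fun f h \<gamma>0 x u = h (f x u) - h x + \<gamma>0 * h x"

definition Gamma_switch :: "real \<Rightarrow> real \<Rightarrow> real \<Rightarrow> real" where
  "Gamma_switch c1 c2 z = -1 / (1 + exp (- c1 * z)) + c2"

definition loss1 :: "real \<Rightarrow> real \<Rightarrow> (real^'n) set \<Rightarrow> (real^'n \<Rightarrow> real) \<Rightarrow> real" where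
  "loss1 \<eta> Lh Xs h = (\<Sum>x\<in>Xs. relu (relu (h x + \<eta>) * (norm (grad h x) - Lh)))"

definition loss2 ::
  "real \<Rightarrow> real \<Rightarrow> real \<Rightarrow> real \<Rightarrow> (real^'n \<Rightarrow> real^'m \<Rightarrow> real^'n) \<Rightarrow> (real^'n) set \<Rightarrow>
   (real^'n \<Rightarrow> real) \<Rightarrow> real \<Rightarrow> (real^'n \<Rightarrow> real^'m) \<Rightarrow> real" where
  "loss2 c1 c2 Lh wmax f Xs h \<gamma>0 \<pi> =
     (\<Sum>x\<in>Xs. relu (Gamma_switch c1 c2 (h x) * (H_fun f h \<gamma>0 x (\<pi> x) - Lh * wmax)))"

(* The area of the superlevel set may be infinite, so the relu is taken in the extended
   reals; its value lies between 0 and \<phi>0 (0 if the area is infinite). *)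
definition loss3_area :: "real \<Rightarrow> (real^'n \<Rightarrow> real) \<Rightarrow> real" where
  "loss3_area \<phi>0 h =
     real_of_ereal (relu (- enn2ereal (emeasure lborel {x. h x \<ge> 0}) + ereal \<phi>0))"

definition loss3_initial :: "(real^'n) set \<Rightarrow> (real^'n \<Rightarrow> real) \<Rightarrow> real" where
  "loss3_initial XI h = (\<Sum>x\<in>XI. relu (- h x))"

definition loss4 :: "real \<Rightarrow> (real^'n) set \<Rightarrow> (real^'n \<Rightarrow> real) \<Rightarrow> real" where
  "loss4 \<delta> Xu h = (\<Sum>x\<in>Xu. relu (h x + \<delta>))"

definition loss5 :: "real \<Rightarrow> real \<Rightarrow> real \<Rightarrow> real" where
  "loss5 \<gamma>min \<gamma>max \<gamma>0 = relu (- \<gamma>0 + \<gamma>min) + relu (\<gamma>0 - \<gamma>max)"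

end

theory Submission imports Defs begin

text \<open>
  Every loss term is a rectified quantity or a finite sum of rectified quantities, hence
  nonnegative. As the weights are positive, a vanishing total loss forces each term to vanish, and
  then each summand, so every rectified argument is nonpositive at every sample
  (\<open>relu_sum_eq_0_iff\<close>). The three claims are read off from the signs of these arguments.

  At a sample \<open>x\<close> with \<open>h x \<ge> 0\<close> the margins work in favour of the constraints: the factor
  \<open>relu (h x + \<eta>)\<close> of the gradient loss is positive, and \<open>h x > - \<zeta>\<close> makes the factor
  \<open>Gamma_switch c1 c2 (h x)\<close> of the decrease loss negative. Dividing by these factors bounds the
  gradient by \<open>Lh\<close> and gives the decrease condition with the witness \<open>u = \<pi> x\<close>, which is an
  admissible input because \<open>hardtanh\<close> clips each component of the policy
  (\<open>policy_in_input_set\<close>). At an unsafe sample \<open>h x + \<delta> \<le> 0\<close> with \<open>\<delta> > 0\<close>. Finally, the loss on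
  \<open>\<gamma>0\<close> confines it to \<open>[\<gamma>min, \<gamma>max] \<subseteq> (0, 1]\<close>, where linear functions belong to
  \<open>K_inf_le_id\<close> (\<open>gamma_fun_in_K_inf_le_id\<close>).
\<close>

lemma relu_nonneg: "0 \<le> relu y"
  by (simp add: relu_def)

lemma relu_eq_0_iff: "relu y = 0 \<longleftrightarrow> y \<le> 0"
  by (auto simp: relu_def max_def)

lemma relu_pos: "0 < y \<Longrightarrow> relu y = y"
  by (simp add: relu_def)

lemma relu_sum_nonneg:
  fixes g :: "'a \<Rightarrow> real"
  shows "0 \<le> (\<Sum>x\<in>A. relu (g x))"
  by (simp add: sum_nonneg relu_nonneg)

lemma relu_sum_eq_0_iff:
  fixes g :: "'a \<Rightarrow> real"
  assumes "finite A"
  shows "(\<Sum>x\<in>A. relu (g x)) = 0 \<longleftrightarrow> (\<forall>x\<in>A. g x \<le> 0)"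
  using assms by (simp add: sum_nonneg_eq_0_iff relu_nonneg relu_eq_0_iff)

text \<open>
  The rectified value is a nonnegative extended real, and \<open>real_of_ereal\<close> preserves
  nonnegativity, also at infinity, which it sends to \<open>0\<close>.
\<close>
lemma loss3_area_nonneg: "0 \<le> loss3_area \<phi>0 h"
  by (simp add: loss3_area_def relu_nonneg real_of_ereal_pos)

lemma hardtanh_bounds:
  assumes "a \<le> b"
  shows "a \<le> hardtanh v a b" "hardtanh v a b \<le> b"
  using assms by (auto simp: hardtanh_def)

lemma policy_in_input_set:
  assumes "\<forall>i. umin $ i \<le> umax $ i"
  shows "policy umin umax \<kappa> x \<in> input_set umin umax"
  using assms by (simp add: input_set_def policy_def network_output_def hardtanh_bounds)

lemma gamma_fun_in_K_inf_le_id: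
  assumes "0 < c" "c \<le> 1"
  shows "gamma_fun c \<in> K_inf_le_id"
proof -
  have "continuous_on {0..} (gamma_fun c)"
    unfolding gamma_fun_def by (intro continuous_intros)
  moreover have "strict_mono_on {0..} (gamma_fun c)"
    using assms by (simp add: strict_mono_on_def gamma_fun_def)
  moreover have "filterlim (gamma_fun c) at_top at_top"
    unfolding gamma_fun_def
    using assms by (intro filterlim_tendsto_pos_mult_at_top[OF tendsto_const] filterlim_ident)
  moreover have "gamma_fun c r \<le> r" if "0 \<le> r" for r
    using assms that by (simp add: gamma_fun_def mult_left_le_one_le)
  ultimately show ?thesis
    using assms by (auto simp: K_inf_le_id_def gamma_fun_def)
qed

theorem theorem1:
  fixes f :: "real^'n \<Rightarrow> real^'m \<Rightarrow> real^'n"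
    and umin umax :: "real^'m"
    and W :: "(real^'n) set" and wmax :: real
    and ns :: nat and s :: "nat \<Rightarrow> real^'n \<Rightarrow> real"
    and Xs Xu :: "(real^'n) set"
    and basis :: "'p::finite \<Rightarrow> real^'n \<Rightarrow> real"
    and h :: "real^'p \<Rightarrow> real^'n \<Rightarrow> real"
    and L3 :: "real^'p \<Rightarrow> real"
    and Lh \<eta> \<delta> \<zeta> \<phi>0 \<alpha>1 \<alpha>2 \<alpha>3 \<alpha>4 \<alpha>5 c1 c2 \<gamma>min \<gamma>max :: real
    and \<theta> :: "real^'p" and \<gamma>0 :: real and \<kappa> :: "'m \<Rightarrow> network"
  assumes input_bounds: "\<forall>i. umin $ i \<le> umax $ i"
    and disturbance_bound: "wmax \<ge> 0" "\<forall>w\<in>W. norm w \<le> wmax"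
    and safe_samples: "finite Xs" "Xs \<subseteq> safe_set ns s"
    and unsafe_samples: "finite Xu" "Xu \<subseteq> - safe_set ns s"
    and basis_C1: "\<forall>j. continuously_differentiable (basis j)"
    and h_param: "\<forall>\<theta>' x. h \<theta>' x = (\<Sum>j\<in>UNIV. \<theta>' $ j * basis j x)"
    and gamma_bounds: "0 < \<gamma>min" "\<gamma>min \<le> \<gamma>max" "\<gamma>max \<le> 1"
    and networks: "\<forall>i. compatible_dims CARD('n) (\<kappa> i)"
    and constants: "Lh \<ge> 0" "\<eta> > 0" "\<delta> > 0" "\<zeta> > 0" "\<phi>0 > 0"
    and weights: "\<alpha>1 > 0" "\<alpha>2 > 0" "\<alpha>3 > 0" "\<alpha>4 > 0" "\<alpha>5 > 0"
    and switch: "c1 > 0" "c2 > 0"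
      "\<forall>z. z > - \<zeta> \<longrightarrow> Gamma_switch c1 c2 z < 0"
      "\<forall>z. z \<le> - \<zeta> \<longrightarrow> Gamma_switch c1 c2 z \<ge> 0"
    and L3_choice: "(\<forall>\<theta>'. L3 \<theta>' = loss3_area \<phi>0 (h \<theta>')) \<or>
      (\<exists>XI. finite XI \<and> (\<forall>\<theta>'. L3 \<theta>' = loss3_initial XI (h \<theta>')))"
    and zero_loss:
      "\<alpha>1 * loss1 \<eta> Lh Xs (h \<theta>)
       + \<alpha>2 * loss2 c1 c2 Lh wmax f Xs (h \<theta>) \<gamma>0 (policy umin umax \<kappa>)
       + \<alpha>3 * L3 \<theta>
       + \<alpha>4 * loss4 \<delta> Xu (h \<theta>)
       + \<alpha>5 * loss5 \<gamma>min \<gamma>max \<gamma>0 = 0"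
  shows "(gamma_fun \<gamma>0 \<in> K_inf_le_id \<and>
          (\<forall>x\<in>Xs. h \<theta> x \<ge> 0 \<longrightarrow>
             (\<exists>u\<in>input_set umin umax.
                h \<theta> (f x u) - h \<theta> x + gamma_fun \<gamma>0 (h \<theta> x) \<ge> Lh * wmax))) \<and>
         (\<forall>x\<in>Xs. h \<theta> x \<ge> 0 \<longrightarrow> norm (grad (h \<theta>) x) \<le> Lh) \<and>
         (\<forall>x\<in>Xu. h \<theta> x < 0)"
proof -
  let ?h = "h \<theta>" and ?\<pi> = "policy umin umax \<kappa>"
  have nonneg: "0 \<le> loss1 \<eta> Lh Xs ?h" "0 \<le> loss2 c1 c2 Lh wmax f Xs ?h \<gamma>0 ?\<pi>"
    "0 \<le> loss4 \<delta> Xu ?h" "0 \<le> loss5 \<gamma>min \<gamma>max \<gamma>0"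
    by (simp_all add: loss1_def loss2_def loss4_def loss5_def relu_sum_nonneg relu_nonneg)
  have "0 \<le> L3 \<theta>"
    using L3_choice by (auto simp: loss3_area_nonneg loss3_initial_def relu_sum_nonneg)
  then have "0 \<le> \<alpha>1 * loss1 \<eta> Lh Xs ?h" "0 \<le> \<alpha>2 * loss2 c1 c2 Lh wmax f Xs ?h \<gamma>0 ?\<pi>"
    "0 \<le> \<alpha>3 * L3 \<theta>" "0 \<le> \<alpha>4 * loss4 \<delta> Xu ?h" "0 \<le> \<alpha>5 * loss5 \<gamma>min \<gamma>max \<gamma>0"
    using nonneg weights by simp_all
  then have "\<alpha>1 * loss1 \<eta> Lh Xs ?h = 0" "\<alpha>2 * loss2 c1 c2 Lh wmax f Xs ?h \<gamma>0 ?\<pi> = 0"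
    "\<alpha>4 * loss4 \<delta> Xu ?h = 0" "\<alpha>5 * loss5 \<gamma>min \<gamma>max \<gamma>0 = 0"
    using zero_loss by linarith+
  then have zero: "loss1 \<eta> Lh Xs ?h = 0" "loss2 c1 c2 Lh wmax f Xs ?h \<gamma>0 ?\<pi> = 0"
    "loss4 \<delta> Xu ?h = 0" "loss5 \<gamma>min \<gamma>max \<gamma>0 = 0"
    using weights by simp_all

  have "relu (\<gamma>min - \<gamma>0) = 0" "relu (\<gamma>0 - \<gamma>max) = 0"
    using zero(4) relu_nonneg[of "\<gamma>min - \<gamma>0"] relu_nonneg[of "\<gamma>0 - \<gamma>max"]
    by (simp_all add: loss5_def)
  then have "0 < \<gamma>0" "\<gamma>0 \<le> 1"
    using gamma_bounds by (simp_all add: relu_eq_0_iff)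
  then have "gamma_fun \<gamma>0 \<in> K_inf_le_id"
    by (rule gamma_fun_in_K_inf_le_id)
  moreover have "\<exists>u\<in>input_set umin umax.
      ?h (f x u) - ?h x + gamma_fun \<gamma>0 (?h x) \<ge> Lh * wmax"
    if "x \<in> Xs" "?h x \<ge> 0" for x
  proof (rule bexI)
    have "Gamma_switch c1 c2 (?h x) * (H_fun f ?h \<gamma>0 x (?\<pi> x) - Lh * wmax) \<le> 0"
      using zero(2) safe_samples(1) that(1) by (simp add: loss2_def relu_sum_eq_0_iff)
    moreover have "Gamma_switch c1 c2 (?h x) < 0"
      using switch(3) constants(4) that(2) by simp
    ultimately have "H_fun f ?h \<gamma>0 x (?\<pi> x) - Lh * wmax \<ge> 0"
      by (simp add: mult_le_0_iff)
    then show "?h (f x (?\<pi> x)) - ?h x + gamma_fun \<gamma>0 (?h x) \<ge> Lh * wmax"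
      by (simp add: H_fun_def gamma_fun_def)
    show "?\<pi> x \<in> input_set umin umax"
      using input_bounds by (rule policy_in_input_set)
  qed
  moreover have "norm (grad ?h x) \<le> Lh" if "x \<in> Xs" "?h x \<ge> 0" for x
  proof -
    have "relu (?h x + \<eta>) * (norm (grad ?h x) - Lh) \<le> 0"
      using zero(1) safe_samples(1) that(1) by (simp add: loss1_def relu_sum_eq_0_iff)
    moreover have "0 < relu (?h x + \<eta>)"
      using constants(2) that(2) by (simp add: relu_pos)
    ultimately show ?thesis
      by (simp add: mult_le_0_iff)
  qed
  moreover have "?h x < 0" if "x \<in> Xu" for x
  proof -
    have "?h x + \<delta> \<le> 0"
      using zero(3) unsafe_samples(1) that by (simp add: loss4_def relu_sum_eq_0_iff)
    then show ?thesis
      using constants(3) by linarith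
  qed
  ultimately show ?thesis
    by blast
qed

end
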